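(* Let $G$ be a graph on $n$ vertices and let $G^b=(V,E^b)$ be $G$ with each edge duplicated $b$ times, for a positive integer $b$. Let $\rho_b=\max_{\emptyset\ne S\subseteq V}|E^b[S]|/|S|$ be the maximum subgraph density of $G^b$. Let $\eta>0$ and $c\ge0$, and let $\overrightarrow{G}^b$ be any orientation of $G^b$ such that every directed edge $\overrightarrow{uv}$ satisfies $d^+(u)\le(1+\eta b^{-1})\,d^+(v)+c$. Then for any $\gamma>0$ there exists a value $k_{\max}\le\log_{1+\gamma}n$ for which \[(1+\eta b^{-1})^{-k_{\max}}\,\Delta(\overrightarrow{G}^b)\le(1+\gamma)\rho_b+c(\eta^{-1}b+1).\]
   Context: $E^b[S]$ is the multiset of edges of $G^b$ with both endpoints in $S$. $d^+(u)$ is the number of edge copies directed out of $u$ in $\overrightarrow{G}^b$, and $\Delta(\overrightarrow{G}^b)=\max_v d^+(v)$. *)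

theory Defs
  imports Complex_Main "HOL-Library.Multiset"
begin

definition simple_graph :: "'a set \<Rightarrow> 'a set set \<Rightarrow> bool" where
  "simple_graph V E \<longleftrightarrow> finite V \<and> (\<forall>e\<in>E. e \<subseteq> V \<and> card e = 2)"

definition dup_edges :: "nat \<Rightarrow> 'a set set \<Rightarrow> 'a set multiset" where
  "dup_edges b E = repeat_mset b (mset_set E)"

definition induced_edges :: "'a set multiset \<Rightarrow> 'a set \<Rightarrow> 'a set multiset" where
  "induced_edges M S = {# e \<in># M. e \<subseteq> S #}"

text \<open>\<^const>\<open>Max\<close> is unspecified on the empty set, so this is meaningful only for
  finite nonempty \<open>V\<close>.\<close>

definition max_density :: "'a set \<Rightarrow> 'a set multiset \<Rightarrow> real" where
  "max_density V M =
     Max {real (size (induced_edges M S)) / real (card S) | S. S \<subseteq> V \<and> S \<noteq> {}}"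

text \<open>An orientation is the multiset of ordered pairs (tail, head) obtained by choosing a
  direction for every edge copy. Parallel copies of the same edge may be directed
  differently.\<close>

definition is_orientation :: "('a \<times> 'a) multiset \<Rightarrow> 'a set multiset \<Rightarrow> bool" where
  "is_orientation D M \<longleftrightarrow> image_mset (\<lambda>(u, v). {u, v}) D = M"

definition outdeg :: "('a \<times> 'a) multiset \<Rightarrow> 'a \<Rightarrow> nat" where
  "outdeg D u = size {# a \<in># D. fst a = u #}"

definition max_outdeg :: "'a set \<Rightarrow> ('a \<times> 'a) multiset \<Rightarrow> nat" where
  "max_outdeg V D = Max (outdeg D ` V)"

end

theory Submission imports Defs begin

text \<open>
  Put \<open>q = 1 + \<eta>/b\<close> and \<open>K = cb/\<eta>\<close>, so that \<open>K(q - 1) = c\<close>. The additive slack \<open>c\<close> is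
  absorbed by shifting the outdegrees: every directed edge satisfies
  \<open>d\<^sup>+(u) + K \<le> q (d\<^sup>+(v) + K)\<close>. Hence every edge leaving a vertex of the level set
  \<open>S\<^sub>k = {v. \<Delta> + K \<le> q\<^sup>k (d\<^sup>+(v) + K)}\<close> lies inside \<open>S\<^sub>k\<^sub>+\<^sub>1\<close>. The level sets cannot grow by a
  factor \<open>1 + \<gamma>\<close> more than \<open>log\<^bsub>1+\<gamma>\<^esub> n\<close> times in a row; at the first \<open>k\<close> where they fail to,
  counting the edges inside \<open>S\<^sub>k\<^sub>+\<^sub>1\<close> bounds the minimum outdegree on \<open>S\<^sub>k\<close>.
\<close>

lemma size_filter_fst_eq_sum_outdeg:
  assumes "finite S"
  shows "size {# a \<in># D. fst a \<in> S #} = (\<Sum>u\<in>S. outdeg D u)"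
proof (induction D)
  case empty
  then show ?case by (simp add: outdeg_def)
next
  case (add a D)
  have "(\<Sum>u\<in>S. outdeg (add_mset a D) u)
      = (\<Sum>u\<in>S. (if fst a = u then 1 else 0) + outdeg D u)"
    by (intro sum.cong) (auto simp: outdeg_def)
  also have "\<dots> = (if fst a \<in> S then 1 else 0) + (\<Sum>u\<in>S. outdeg D u)"
    using assms by (simp add: sum.distrib)
  finally show ?case using add by simp
qed

text \<open>Each edge copy with tail in \<open>S\<close> counts once in the sum, through that tail,
  and \<open>closed\<close> puts both its ends in \<open>T\<close>. Applied below with consecutive
  level sets as \<open>S\<close> and \<open>T\<close>.\<close>

lemma sum_outdeg_le_size_induced_edges:
  assumes "finite S" and D: "is_orientation D M"
    and closed: "\<And>u v. (u, v) \<in># D \<Longrightarrow> u \<in> S \<Longrightarrow> u \<in> T \<and> v \<in> T"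
  shows "(\<Sum>u\<in>S. outdeg D u) \<le> size (induced_edges M T)"
proof -
  have "{# a \<in># D. fst a \<in> S #} \<subseteq># {# a \<in># D. (\<lambda>(u, v). {u, v}) a \<subseteq> T #}"
    using closed by (intro filter_mset_mono_strong) auto
  then have "size {# a \<in># D. fst a \<in> S #} \<le> size {# a \<in># D. (\<lambda>(u, v). {u, v}) a \<subseteq> T #}"
    by (rule size_mset_mono)
  also have "\<dots> = size (induced_edges M T)"
    using D by (auto simp: is_orientation_def induced_edges_def filter_mset_image_mset)
  finally show ?thesis
    using size_filter_fst_eq_sum_outdeg[OF assms(1), of D] by simp
qed

lemma size_induced_edges_le_max_density:
  assumes "finite V" "S \<subseteq> V" "S \<noteq> {}"
  shows "real (size (induced_edges M S)) \<le> max_density V M * real (card S)"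
proof -
  have fin: "finite {real (size (induced_edges M S)) / real (card S) | S. S \<subseteq> V \<and> S \<noteq> {}}"
    using assms(1) by simp
  have "real (size (induced_edges M S)) / real (card S) \<le> max_density V M"
    unfolding max_density_def using assms by (intro Max_ge[OF fin]) blast
  moreover have "card S > 0"
    using assms by (simp add: card_gt_0_iff finite_subset)
  ultimately show ?thesis
    by (simp add: divide_le_eq)
qed

text \<open>The density of \<open>V\<close> itself is a nonnegative lower bound. This permits
  multiplying a cardinality inequality by the maximum density.\<close>

lemma max_density_nonneg:
  assumes "finite V" "V \<noteq> {}"
  shows "0 \<le> max_density V M"
proof -
  have "0 \<le> max_density V M * real (card V)"
    using size_induced_edges_le_max_density[OF assms(1) subset_refl assms(2), of M]
    by (rule order_trans[OF of_nat_0_le_iff])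
  then show ?thesis
    using assms by (simp add: zero_le_mult_iff card_gt_0_iff)
qed

lemma is_orientation_dup_edges_endpoints:
  assumes "simple_graph V E" "is_orientation D (dup_edges b E)" "(u, v) \<in># D"
  shows "u \<in> V" "v \<in> V"
proof -
  have "E \<subseteq> Pow V" "finite V"
    using assms(1) by (auto simp: simple_graph_def)
  then have "finite E"
    by (meson finite_Pow_iff finite_subset)
  have "{u, v} \<in># image_mset (\<lambda>(u, v). {u, v}) D"
    using assms(3) by force
  then have "{u, v} \<in># repeat_mset b (mset_set E)"
    using assms(2) by (simp only: is_orientation_def dup_edges_def)
  \<comment> \<open>Membership in the repeated multiset forces a nonzero count in
    \<open>mset_set E\<close>, which for finite \<open>E\<close> means membership in
    \<open>E\<close>.\<close>
  then have "{u, v} \<in> E"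
    using \<open>finite E\<close>
    by (metis count_inI count_repeat_mset elem_mset_set mult_0_right not_in_iff)
  then show "u \<in> V" "v \<in> V"
    using \<open>E \<subseteq> Pow V\<close> by auto
qed

text \<open>Before the first slow step every step multiplies \<open>a\<close> by more than
  \<open>1 + \<gamma>\<close>, so the index \<open>k\<close> of that step satisfies
  \<open>(1 + \<gamma>) ^ k \<le> a k \<le> n\<close>.\<close>

lemma exists_slow_growth_step:
  fixes a :: "nat \<Rightarrow> nat" and \<gamma> :: real
  assumes "\<gamma> > 0" and "a 0 \<ge> 1" and bound: "\<And>k. a k \<le> n"
  obtains k where "real k \<le> log (1 + \<gamma>) (real n)" "real (a (Suc k)) \<le> (1 + \<gamma>) * real (a k)"
proof -
  let ?slow = "\<lambda>k. real (a (Suc k)) \<le> (1 + \<gamma>) * real (a k)"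
  have growth: "(1 + \<gamma>) ^ k \<le> real (a k)" if "\<And>j. j < k \<Longrightarrow> \<not> ?slow j" for k
    using that
  proof (induction k)
    case 0
    then show ?case using assms(2) by simp
  next
    case (Suc k)
    then have "(1 + \<gamma>) ^ k \<le> real (a k)" and fast: "\<not> ?slow k" by auto
    then have "(1 + \<gamma>) * (1 + \<gamma>) ^ k \<le> (1 + \<gamma>) * real (a k)"
      using \<open>\<gamma> > 0\<close> by (intro mult_left_mono) auto
    then show ?case using fast by simp
  qed
  \<comment> \<open>If no step were slow, \<open>a N\<close> would exceed \<open>n\<close>; hence a
    first slow step exists.\<close>
  obtain N where N: "real n < (1 + \<gamma>) ^ N"
    using real_arch_pow[of "1 + \<gamma>" "real n"] \<open>\<gamma> > 0\<close> by auto
  have "\<exists>k. ?slow k"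
  proof (rule ccontr)
    assume "\<nexists>k. ?slow k"
    then have "(1 + \<gamma>) ^ N \<le> real (a N)" by (intro growth) blast
    then show False using N bound[of N] by linarith
  qed
  then obtain k where k: "?slow k" and "\<And>j. j < k \<Longrightarrow> \<not> ?slow j"
    using exists_least_iff[of ?slow] by blast
  from this(2) have "(1 + \<gamma>) ^ k \<le> real (a k)" by (rule growth)
  then have "(1 + \<gamma>) ^ k \<le> real n" using bound[of k] by linarith
  then have "real k \<le> log (1 + \<gamma>) (real n)"
    using \<open>\<gamma> > 0\<close> by (intro le_log_of_power) auto
  then show ?thesis using k by (rule that)
qed

theorem theorem2:
  fixes V :: "'a set" and E :: "'a set set" and D :: "('a \<times> 'a) multiset"
    and n b :: nat and \<eta> c \<gamma> :: real
  assumes "simple_graph V E" and "card V = n" and "V \<noteq> {}"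
    and "b > 0"
    and "\<eta> > 0" and "c \<ge> 0"
    and "is_orientation D (dup_edges b E)"
    and "\<And>u v. (u, v) \<in># D \<Longrightarrow>
           real (outdeg D u) \<le> (1 + \<eta> / real b) * real (outdeg D v) + c"
    and "\<gamma> > 0"
  shows "\<exists>k\<^sub>m\<^sub>a\<^sub>x::nat. real k\<^sub>m\<^sub>a\<^sub>x \<le> log (1 + \<gamma>) (real n) \<and>
           (1 + \<eta> / real b) powi (- int k\<^sub>m\<^sub>a\<^sub>x) * real (max_outdeg V D)
             \<le> (1 + \<gamma>) * max_density V (dup_edges b E) + c * (real b / \<eta> + 1)"
proof -
  define q where "q = 1 + \<eta> / real b"
  define K where "K = c * real b / \<eta>"
  define \<Delta> where "\<Delta> = real (max_outdeg V D)"
  define d where "d = (\<lambda>v. real (outdeg D v))"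
  define S where "S = (\<lambda>k. {v \<in> V. \<Delta> + K \<le> q ^ k * (d v + K)})"
  let ?M = "dup_edges b E"
  let ?\<rho> = "max_density V ?M"
  have finV: "finite V" using assms(1) by (simp add: simple_graph_def)
  have "q > 1" using \<open>b > 0\<close> \<open>\<eta> > 0\<close> by (simp add: q_def)
  have "K \<ge> 0" using \<open>\<eta> > 0\<close> \<open>c \<ge> 0\<close> by (simp add: K_def)
  have qK: "q * K = K + c"
    using \<open>b > 0\<close> \<open>\<eta> > 0\<close> by (simp add: q_def K_def field_simps)
  have S_sub: "S k \<subseteq> V" for k by (auto simp: S_def)
  have finS: "finite (S k)" for k using finV S_sub by (rule rev_finite_subset)
  have S_mono: "S k \<subseteq> S (Suc k)" for k
  proof
    fix v assume v: "v \<in> S k"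
    have "1 * (q ^ k * (d v + K)) \<le> q * (q ^ k * (d v + K))"
      using \<open>q > 1\<close> \<open>K \<ge> 0\<close> by (intro mult_right_mono) (auto simp: d_def)
    then show "v \<in> S (Suc k)" using v by (simp add: S_def mult.assoc)
  qed
  \<comment> \<open>A vertex attaining the maximum lies in \<open>S 0\<close>, so by monotonicity no
    level set is empty.\<close>
  have "max_outdeg V D \<in> outdeg D ` V"
    unfolding max_outdeg_def using finV \<open>V \<noteq> {}\<close> by (intro Max_in) auto
  then obtain w where "w \<in> V" "\<Delta> = d w" by (auto simp: \<Delta>_def d_def)
  then have "w \<in> S 0" by (simp add: S_def)
  then have S_ne: "S k \<noteq> {}" for k
    using lift_Suc_mono_le[of S 0 k] S_mono by auto
  have step: "u \<in> S (Suc k) \<and> v \<in> S (Suc k)" if "(u, v) \<in># D" "u \<in> S k" for u v k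
  proof -
    have "d u + K \<le> q * (d v + K)"
      using assms(8)[OF that(1)] qK by (simp add: d_def q_def distrib_left)
    then have "q ^ k * (d u + K) \<le> q ^ k * (q * (d v + K))"
      using \<open>q > 1\<close> by (intro mult_left_mono) auto
    then have "\<Delta> + K \<le> q ^ Suc k * (d v + K)"
      using that(2) by (simp add: S_def mult_ac)
    then show ?thesis
      using is_orientation_dup_edges_endpoints(2)[OF assms(1,7) that(1)] S_mono that(2)
      by (auto simp: S_def)
  qed
  have "card (S 0) \<ge> 1" using finS S_ne by (simp add: Suc_le_eq card_gt_0_iff)
  moreover have "card (S k) \<le> n" for k
    using card_mono[OF finV S_sub] \<open>card V = n\<close> by simp
  ultimately obtain k where k: "real k \<le> log (1 + \<gamma>) (real n)"
    and slow: "real (card (S (Suc k))) \<le> (1 + \<gamma>) * real (card (S k))"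
    using exists_slow_growth_step[of \<gamma> "\<lambda>k. card (S k)" n] \<open>\<gamma> > 0\<close> by blast
  \<comment> \<open>The membership condition of \<open>S k\<close> solved for \<open>d v\<close>:
    its vertices are those of outdegree at least \<open>x\<close>. The sign of \<open>x\<close> is
    irrelevant to the averaging that follows.\<close>
  define x where "x = (\<Delta> + K) / q ^ k - K"
  have "x \<le> d u" if "u \<in> S k" for u
    using that \<open>q > 1\<close> by (simp add: x_def S_def field_simps)
  then have "real (card (S k)) * x \<le> (\<Sum>u\<in>S k. d u)"
    by (rule sum_bounded_below)
  also have "\<dots> \<le> real (size (induced_edges ?M (S (Suc k))))"
    using sum_outdeg_le_size_induced_edges[OF finS assms(7) step, of k]
    by (simp add: d_def flip: of_nat_sum)
  also have "\<dots> \<le> ?\<rho> * real (card (S (Suc k)))"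
    by (rule size_induced_edges_le_max_density[OF finV S_sub S_ne])
  also have "\<dots> \<le> ?\<rho> * ((1 + \<gamma>) * real (card (S k)))"
    using slow max_density_nonneg[OF finV \<open>V \<noteq> {}\<close>] by (rule mult_left_mono)
  finally have "real (card (S k)) * x \<le> real (card (S k)) * ((1 + \<gamma>) * ?\<rho>)"
    by (simp add: mult_ac)
  moreover have "real (card (S k)) > 0" using finS S_ne by (simp add: card_gt_0_iff)
  ultimately have x: "x \<le> (1 + \<gamma>) * ?\<rho>" by simp
  have "q powi (- int k) * \<Delta> = \<Delta> / q ^ k"
    by (simp add: power_int_minus field_simps)
  \<comment> \<open>Here \<open>x + K\<close> is \<open>(\<Delta> + K) / q ^ k\<close>, so undoing
    the shift costs at most \<open>K\<close>.\<close>
  also have "\<dots> \<le> x + K"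
    using \<open>q > 1\<close> \<open>K \<ge> 0\<close> by (simp add: x_def divide_right_mono)
  \<comment> \<open>The additive term on the right equals \<open>K + c\<close>, which dominates
    \<open>K\<close>.\<close>
  also have "\<dots> \<le> (1 + \<gamma>) * ?\<rho> + c * (real b / \<eta> + 1)"
    using x \<open>c \<ge> 0\<close> by (simp add: K_def distrib_left)
  finally show ?thesis
    using k unfolding q_def \<Delta>_def by blast
qed

end
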